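(* Let $s_7(n)=\sum_{k=0}^n\binom{n}{k}^2\binom{n+k}{k}\binom{2k}{n}$ and $s_{18}(n)=\sum_{k=0}^{n}(-1)^k\binom{n}{k}\binom{2k}{k}\binom{2(n-k)}{n-k}\binom{2n-3k}{n}$ for $n\ge0$. For any prime $p$: $s_7(p-j)\equiv0\pmod p$ whenever $1\le j\le(p+1)/3$, and $s_{18}(p-j)\equiv0\pmod p$ whenever $1\le j\le(p+2)/4$.
   Context: For integers $m\ge0$ and any number $x$, $\binom{x}{m}=\frac{x(x-1)\cdots(x-m+1)}{m!}$ (so the upper entry $2n-3k$ may be negative). Equivalently, $s_{18}(0)=1$ and for $n\ge1$, $s_{18}(n)=\sum_{k=0}^{\lfloor n/3\rfloor}(-1)^k\binom{n}{k}\binom{2k}{k}\binom{2(n-k)}{n-k}\bigl[\binom{2n-3k-1}{n}+\binom{2n-3k}{n}\bigr]$. *)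

theory Defs
  imports "HOL-Number_Theory.Number_Theory"
begin

(* The library's generalized binomial coefficient, taken at type int so that congruences
   between sums of such coefficients make sense; under Complex_Main the term "x gchoose m"
   with x :: int is read as a real number. The division is exact, see of_int_zbinom. *)
definition zbinom :: "int \<Rightarrow> nat \<Rightarrow> int" where
  "zbinom x m = (\<Prod>i=0..<m. x - int i) div fact m"

lemma of_int_zbinom: "of_int (zbinom x m) = (of_int x :: 'a::field_char_0) gchoose m"
  unfolding zbinom_def gbinomial_prod_rev[where 'a = int, symmetric] by (rule of_int_gbinomial)

definition s7 :: "nat \<Rightarrow> int" where
  "s7 n = (\<Sum>k=0..n. int ((n choose k)\<^sup>2 * ((n + k) choose k) * ((2 * k) choose n)))"

definition s18 :: "nat \<Rightarrow> int" where
  "s18 n = (\<Sum>k=0..n. (-1) ^ k * int (n choose k) * int ((2 * k) choose k)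
              * int ((2 * (n - k)) choose (n - k)) * zbinom (2 * int n - 3 * int k) n)"

end

theory Submission
  imports Defs
begin

text \<open>
  Every single summand vanishes modulo \<open>p\<close>. A binomial coefficient \<open>a + b choose b\<close> with
  \<open>a, b < p \<le> a + b\<close> is divisible by \<open>p\<close>. With \<open>n = p - j\<close>, the bound on \<open>j\<close> makes
  this apply to \<open>n + k choose k\<close> as soon as \<open>2 k \<ge> n\<close>, which settles \<open>s7\<close>. For
  \<open>s18\<close> it applies to one of the two central binomial coefficients unless both \<open>2 k < p\<close> and
  \<open>2 (n - k) < p\<close>; in that case \<open>0 \<le> 2 n - 3 k < n\<close>, so the last factor is zero.
\<close>

text \<open>The prime divides \<open>fact (a + b)\<close> but neither \<open>fact a\<close> nor
  \<open>fact b\<close>, so it must divide the remaining factor.\<close>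

lemma prime_dvd_choose_carry:
  fixes p a b :: nat
  assumes "prime p" "a < p" "b < p" "p \<le> a + b"
  shows "p dvd (a + b choose b)"
proof -
  have "p dvd fact b * fact a * (a + b choose b)"
    using binomial_fact_lemma[of b "a + b"] assms by (simp add: prime_dvd_fact_iff)
  then show ?thesis
    using assms by (simp add: prime_dvd_mult_iff prime_dvd_fact_iff)
qed

text \<open>The falling product contains the factor \<open>x - x\<close>.\<close>

lemma zbinom_eq_0:
  assumes "0 \<le> x" "x < int m"
  shows "zbinom x m = 0"
proof -
  have "(\<Prod>i=0..<m. x - int i) = 0"
    using assms by (intro prod_zero bexI[of _ "nat x"]) auto
  then show ?thesis
    by (simp only: zbinom_def div_0)
qed

lemma prime_dvd_s7:
  assumes p: "prime p" and j: "1 \<le> j" "3 * j \<le> p + 1"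
  shows "int p dvd s7 (p - j)"
  unfolding s7_def
proof (rule dvd_sum)
  fix k assume k: "k \<in> {0..p - j}"
  let ?n = "p - j"
  have "p dvd (?n choose k)\<^sup>2 * (?n + k choose k) * (2 * k choose ?n)"
  proof (cases "2 * k < ?n")
    case True
    then show ?thesis by (simp add: binomial_eq_0)
  next
    case False
    \<comment> \<open>Here \<open>2 * k \<ge> p - j \<ge> 2 * j - 1\<close>; by parity
      \<open>k \<ge> j\<close>, so \<open>?n + k \<ge> p\<close>.\<close>
    then have "p dvd (?n + k choose k)"
      using k j prime_gt_0_nat[OF p] by (intro prime_dvd_choose_carry[OF p]) auto
    then show ?thesis by simp
  qed
  then show "int p dvd int ((?n choose k)\<^sup>2 * (?n + k choose k) * (2 * k choose ?n))"
    by (simp only: int_dvd_int_iff)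
qed

lemma prime_dvd_s18:
  assumes p: "prime p" and j: "1 \<le> j" "4 * j \<le> p + 2"
  shows "int p dvd s18 (p - j)"
  unfolding s18_def
proof (rule dvd_sum)
  fix k assume k: "k \<in> {0..p - j}"
  let ?n = "p - j"
  have central: "int p dvd int (2 * m choose m)" if "m < p" "p \<le> 2 * m" for m
    using prime_dvd_choose_carry[OF p that(1) that(1)] that(2) by (simp add: mult_2)
  have small: "k < p" "?n - k < p"
    using k j prime_gt_0_nat[OF p] by auto
  consider "p \<le> 2 * k" | "p \<le> 2 * (?n - k)" | "2 * k < p" "2 * (?n - k) < p"
    by linarith
  then show "int p dvd (-1) ^ k * int (?n choose k) * int (2 * k choose k)
      * int (2 * (?n - k) choose (?n - k)) * zbinom (2 * int ?n - 3 * int k) ?n"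
  proof cases
    case 1
    then show ?thesis using central[OF small(1)] by simp
  next
    case 2
    then show ?thesis using central[OF small(2)] by simp
  next
    case 3
    \<comment> \<open>The case gives \<open>p - 2 * j + 1 \<le> 2 * k \<le> p - 1\<close>; tripling
      and using \<open>4 * j \<le> p + 2\<close> yields
      \<open>?n < 3 * k \<le> 2 * ?n\<close>.\<close>
    then have "zbinom (2 * int ?n - 3 * int k) ?n = 0"
      using k j prime_gt_1_nat[OF p] by (intro zbinom_eq_0) auto
    then show ?thesis by simp
  qed
qed

theorem theorem6p6:
  fixes p :: nat
  assumes "prime p"
  shows "(\<forall>j::nat. 1 \<le> j \<and> real j \<le> (real p + 1) / 3 \<longrightarrow> [s7 (p - j) = 0] (mod int p)) \<and>
         (\<forall>j::nat. 1 \<le> j \<and> real j \<le> (real p + 2) / 4 \<longrightarrow> [s18 (p - j) = 0] (mod int p))"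
  using prime_dvd_s7[OF assms] prime_dvd_s18[OF assms] by (auto simp: cong_0_iff)

end
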